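(* Let $r=(r_n)$, $t=(t_n)$ be scalar sequences with $r_n\neq 0$ and $t_n\neq 0$ for all $n\in\mathbb{N}_0$, and let $s=(s_n)$ be a scalar sequence with $s_0\neq 0$. For each $X\in\{l_\infty,c,c_0\}$, the sequence space $X(r,s,t;\Delta)$ is a complete normed linear space under the norm $$\|x\|_{X(r,s,t;\Delta)}=\sup_{n}\Big|\frac{1}{r_n}\sum_{k=0}^{n}s_{n-k}t_k\Delta x_k\Big| .$$
   Context: $\mathbb{N}_0=\{0,1,2,\dots\}$; $w$ is the space of all real (or all complex) sequences $x=(x_n)_{n\in\mathbb{N}_0}$. $l_\infty$, $c$, $c_0$ are the spaces of bounded, convergent and null sequences. $\Delta x_k=x_k-x_{k-1}$ with $x_{-1}=0$. For $X\in\{l_\infty,c,c_0\}$, $$X(r,s,t;\Delta)=\Big\{x\in w:\Big(\frac{1}{r_n}\sum_{k=0}^{n}s_{n-k}t_k\Delta x_k\Big)_{n}\in X\Big\}.$$ *)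

theory Defs
  imports "HOL-Analysis.Analysis" "HOL-Library.Function_Algebras"
begin

text \<open>
  The scalars are an arbitrary complete normed field over the reals,
  \<open>'a :: {real_normed_field, banach}\<close>. Both \<open>real\<close> and \<open>complex\<close> are instances, and up to
  isometric isomorphism there are no others. The space \<open>w\<close> of all sequences is the type
  \<open>nat \<Rightarrow> 'a\<close>, with the pointwise group structure of \<open>Function_Algebras\<close> and the following
  scalar multiplication.
\<close>

definition seq_scale :: "'a::field \<Rightarrow> (nat \<Rightarrow> 'a) \<Rightarrow> (nat \<Rightarrow> 'a)" where
  "seq_scale a x = (\<lambda>n. a * x n)"

definition l_infty :: "(nat \<Rightarrow> 'a::real_normed_vector) set" where
  "l_infty = {x. bounded (range x)}"

definition c_conv :: "(nat \<Rightarrow> 'a::real_normed_vector) set" where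
  "c_conv = {x. convergent x}"

definition c_null :: "(nat \<Rightarrow> 'a::real_normed_vector) set" where
  "c_null = {x. x \<longlonglongrightarrow> 0}"

text \<open>The case \<open>k = 0\<close> implements the convention that the term with index \<open>-1\<close> is zero.\<close>

definition bdiff :: "(nat \<Rightarrow> 'a::ab_group_add) \<Rightarrow> nat \<Rightarrow> 'a" where
  "bdiff x k = x k - (if k = 0 then 0 else x (k - 1))"

definition gen_mean :: "(nat \<Rightarrow> 'a::field) \<Rightarrow> (nat \<Rightarrow> 'a) \<Rightarrow> (nat \<Rightarrow> 'a) \<Rightarrow> (nat \<Rightarrow> 'a) \<Rightarrow> nat \<Rightarrow> 'a" where
  "gen_mean r s t x n = 1 / r n * (\<Sum>k=0..n. s (n - k) * t k * bdiff x k)"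

definition mean_space ::
  "(nat \<Rightarrow> 'a::field) set \<Rightarrow> (nat \<Rightarrow> 'a) \<Rightarrow> (nat \<Rightarrow> 'a) \<Rightarrow> (nat \<Rightarrow> 'a) \<Rightarrow> (nat \<Rightarrow> 'a) set" where
  "mean_space X r s t = {x. gen_mean r s t x \<in> X}"

text \<open>
  The supremum is taken in \<open>real\<close>, so this is meaningful only where the values are bounded;
  in particular on \<open>mean_space X r s t\<close> when \<open>X\<close> consists of bounded sequences.
\<close>

definition mean_norm ::
  "(nat \<Rightarrow> 'a::real_normed_field) \<Rightarrow> (nat \<Rightarrow> 'a) \<Rightarrow> (nat \<Rightarrow> 'a) \<Rightarrow> (nat \<Rightarrow> 'a) \<Rightarrow> real" where
  "mean_norm r s t x = (SUP n. norm (gen_mean r s t x n))"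

definition normed_space_on ::
  "('a::real_normed_field \<Rightarrow> 'v::ab_group_add \<Rightarrow> 'v) \<Rightarrow> 'v set \<Rightarrow> ('v \<Rightarrow> real) \<Rightarrow> bool" where
  "normed_space_on smul V N \<longleftrightarrow>
     vector_space smul \<and> module.subspace smul V \<and>
     (\<forall>x\<in>V. 0 \<le> N x) \<and>
     (\<forall>x\<in>V. N x = 0 \<longleftrightarrow> x = 0) \<and>
     (\<forall>a. \<forall>x\<in>V. N (smul a x) = norm a * N x) \<and>
     (\<forall>x\<in>V. \<forall>y\<in>V. N (x + y) \<le> N x + N y)"

text \<open>
  The locale \<open>Metric_space\<close> demands nonnegativity and symmetry of the distance on the whole
  type, while \<open>N\<close> is only controlled on \<open>V\<close>; hence the value 0 outside \<open>V\<close>.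
\<close>

definition norm_dist :: "'v::ab_group_add set \<Rightarrow> ('v \<Rightarrow> real) \<Rightarrow> 'v \<Rightarrow> 'v \<Rightarrow> real" where
  "norm_dist V N x y = (if x \<in> V \<and> y \<in> V then N (x - y) else 0)"

definition complete_normed_space_on ::
  "('a::real_normed_field \<Rightarrow> 'v::ab_group_add \<Rightarrow> 'v) \<Rightarrow> 'v set \<Rightarrow> ('v \<Rightarrow> real) \<Rightarrow> bool" where
  "complete_normed_space_on smul V N \<longleftrightarrow>
     normed_space_on smul V N \<and> Metric_space.mcomplete V (norm_dist V N)"

lemma Metric_space_norm_dist:
  assumes "normed_space_on smul V N"
  shows "Metric_space V (norm_dist V N)"
proof -
  have vs: "vector_space smul" and sub: "module.subspace smul V"
    and nonneg: "\<And>x. x \<in> V \<Longrightarrow> 0 \<le> N x"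
    and zero: "\<And>x. x \<in> V \<Longrightarrow> N x = 0 \<longleftrightarrow> x = 0"
    and hom: "\<And>a x. x \<in> V \<Longrightarrow> N (smul a x) = norm a * N x"
    and tri: "\<And>x y. x \<in> V \<Longrightarrow> y \<in> V \<Longrightarrow> N (x + y) \<le> N x + N y"
    using assms by (simp_all only: normed_space_on_def Ball_def)
  interpret vector_space smul by (rule vs)
  have diff: "x - y \<in> V" if "x \<in> V" "y \<in> V" for x y
    using subspace_diff[OF sub that] .
  have sym: "N (x - y) = N (y - x)" if "x \<in> V" "y \<in> V" for x y
    using hom[OF diff[OF that], of "- 1"] by (simp only: scale_minus_left scale_one norm_minus_cancel norm_one mult_1 minus_diff_eq)
  have tri': "N (x - z) \<le> N (x - y) + N (y - z)" if "x \<in> V" "y \<in> V" "z \<in> V" for x y z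
    using tri[OF diff[OF that(1,2)] diff[OF that(2,3)]] by simp
  show ?thesis
  proof
    show "0 \<le> norm_dist V N x y" for x y
      by (simp add: norm_dist_def nonneg diff)
    show "norm_dist V N x y = norm_dist V N y x" for x y
      using sym[of x y] by (auto simp: norm_dist_def)
    show "norm_dist V N x y = 0 \<longleftrightarrow> x = y" if "x \<in> V" "y \<in> V" for x y
      by (simp add: norm_dist_def that zero diff)
    show "norm_dist V N x z \<le> norm_dist V N x y + norm_dist V N y z"
      if "x \<in> V" "y \<in> V" "z \<in> V" for x y z
      using tri'[OF that] by (simp add: norm_dist_def that)
  qed
qed

end

theory Submission
  imports Defs
begin

text \<open>
  The map \<open>gen_mean r s t\<close> is a linear bijection of the space of all sequences. The space
  \<open>mean_space X r s t\<close> is the preimage of \<open>X\<close> under it and \<open>mean_norm r s t\<close> is the pullback of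
  the supremum norm, so the theorem says no more than that \<open>l_infty\<close>, \<open>c_conv\<close> and \<open>c_null\<close> are
  Banach spaces under the supremum norm.

  Bijectivity (\<open>bij_gen_mean\<close>) is a matter of factorisation: up to pointwise division by the
  nonzero \<open>r n\<close>, the mean takes differences, multiplies pointwise by the nonzero \<open>t k\<close>, and
  convolves with \<open>s\<close>. Differencing is undone by partial sums, and convolution with \<open>s\<close> is
  multiplication by a formal power series that is invertible because \<open>s 0\<close> is nonzero.

  The three classical spaces are treated together: each is a linear space of bounded sequences
  that is closed under uniform limits, and every such space is complete
  (\<open>complete_sup_normed\<close>). Completeness then moves back along the bijection
  (\<open>complete_normed_space_on_pullback\<close>).
\<close>

section \<open>Completeness of a normed subspace in terms of norms\<close>

lemma mcomplete_norm_dist_iff: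
  assumes "normed_space_on smul V N"
  shows "Metric_space.mcomplete V (norm_dist V N) \<longleftrightarrow>
    (\<forall>\<sigma>. range \<sigma> \<subseteq> V \<longrightarrow> (\<forall>\<epsilon>>0. \<exists>K. \<forall>m\<ge>K. \<forall>n\<ge>K. N (\<sigma> m - \<sigma> n) < \<epsilon>) \<longrightarrow>
      (\<exists>x\<in>V. (\<lambda>n. N (\<sigma> n - x)) \<longlonglongrightarrow> 0))"
proof -
  interpret Metric_space V "norm_dist V N"
    using assms by (rule Metric_space_norm_dist)
  have Cauchy_iff: "MCauchy \<sigma> \<longleftrightarrow> (\<forall>\<epsilon>>0. \<exists>K. \<forall>m\<ge>K. \<forall>n\<ge>K. N (\<sigma> m - \<sigma> n) < \<epsilon>)"
    if "range \<sigma> \<subseteq> V" for \<sigma>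
  proof -
    have "norm_dist V N (\<sigma> m) (\<sigma> n) = N (\<sigma> m - \<sigma> n)" for m n
      using that by (auto simp: norm_dist_def)
    then show ?thesis
      using that by (auto simp: MCauchy_def)
  qed
  have limit_iff: "limitin mtopology \<sigma> x sequentially \<longleftrightarrow> x \<in> V \<and> (\<lambda>n. N (\<sigma> n - x)) \<longlonglongrightarrow> 0"
    if "range \<sigma> \<subseteq> V" for \<sigma> x
  proof (cases "x \<in> V")
    case True
    have "norm_dist V N (\<sigma> n) x = N (\<sigma> n - x)" for n
      using that True by (auto simp: norm_dist_def)
    then show ?thesis
      using that True by (auto simp: limitin_metric_dist_null intro!: always_eventually)
  qed (simp add: limitin_metric)
  have "MCauchy \<sigma> \<Longrightarrow> range \<sigma> \<subseteq> V" for \<sigma>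
    by (simp add: MCauchy_def)
  then show ?thesis
    unfolding mcomplete_def using Cauchy_iff limit_iff by meson
qed

section \<open>Pulling a complete norm back along a linear bijection\<close>

lemma normed_space_on_pullback:
  assumes lin: "Vector_Spaces.linear smul1 smul2 T" and "inj T"
    and norm: "normed_space_on smul2 V N"
  shows "normed_space_on smul1 (T -` V) (\<lambda>x. N (T x))"
proof -
  interpret Vector_Spaces.linear smul1 smul2 T
    by (rule lin)
  have sub: "vs2.subspace V"
    and nonneg: "\<And>x. x \<in> V \<Longrightarrow> 0 \<le> N x"
    and zero_iff: "\<And>x. x \<in> V \<Longrightarrow> N x = 0 \<longleftrightarrow> x = 0"
    and hom: "\<And>a x. x \<in> V \<Longrightarrow> N (smul2 a x) = norm a * N x"
    and tri: "\<And>x y. x \<in> V \<Longrightarrow> y \<in> V \<Longrightarrow> N (x + y) \<le> N x + N y"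
    using norm by (simp_all only: normed_space_on_def Ball_def)
  have "T x = 0 \<longleftrightarrow> x = 0" for x
    using injD[OF \<open>inj T\<close>, of x 0] zero by auto
  then show ?thesis
    unfolding normed_space_on_def
    using vs1.vector_space_axioms subspace_vimage[OF sub]
    by (auto simp: nonneg zero_iff hom tri add scale)
qed

text \<open>
  For the pulled-back norm \<open>T\<close> is an isometry onto \<open>V\<close>: a Cauchy sequence is carried to a Cauchy
  sequence in \<open>V\<close>, and surjectivity brings its limit back.
\<close>

lemma complete_normed_space_on_pullback:
  assumes lin: "Vector_Spaces.linear smul1 smul2 T" and "bij T"
    and compl: "complete_normed_space_on smul2 V N"
  shows "complete_normed_space_on smul1 (T -` V) (\<lambda>x. N (T x))"
proof -
  interpret Vector_Spaces.linear smul1 smul2 T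
    by (rule lin)
  have norm2: "normed_space_on smul2 V N"
    and mcompl: "Metric_space.mcomplete V (norm_dist V N)"
    using compl by (simp_all add: complete_normed_space_on_def)
  have norm1: "normed_space_on smul1 (T -` V) (\<lambda>x. N (T x))"
    using normed_space_on_pullback[OF lin bij_is_inj[OF \<open>bij T\<close>] norm2] .
  have "\<exists>x\<in>T -` V. (\<lambda>n. N (T (\<sigma> n - x))) \<longlonglongrightarrow> 0"
    if "range \<sigma> \<subseteq> T -` V"
      and "\<forall>\<epsilon>>0. \<exists>K. \<forall>m\<ge>K. \<forall>n\<ge>K. N (T (\<sigma> m - \<sigma> n)) < \<epsilon>" for \<sigma>
  proof -
    have "range (T \<circ> \<sigma>) \<subseteq> V"
      using that(1) by auto
    moreover have "\<forall>\<epsilon>>0. \<exists>K. \<forall>m\<ge>K. \<forall>n\<ge>K. N ((T \<circ> \<sigma>) m - (T \<circ> \<sigma>) n) < \<epsilon>"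
      using that(2) by (simp add: diff)
    ultimately obtain y where y: "y \<in> V" "(\<lambda>n. N ((T \<circ> \<sigma>) n - y)) \<longlonglongrightarrow> 0"
      using mcompl unfolding mcomplete_norm_dist_iff[OF norm2] by blast
    moreover obtain x where "y = T x"
      using bij_is_surj[OF \<open>bij T\<close>] by (rule surjE)
    ultimately show ?thesis
      by (intro bexI[of _ x]) (simp_all add: diff)
  qed
  with norm1 show ?thesis
    by (simp add: complete_normed_space_on_def mcomplete_norm_dist_iff[OF norm1])
qed

section \<open>Sequence spaces under the supremum norm\<close>

definition sup_norm :: "(nat \<Rightarrow> 'a::real_normed_vector) \<Rightarrow> real" where
  "sup_norm y = (SUP n. norm (y n))"

lemma norm_le_sup_norm:
  assumes "y \<in> l_infty"
  shows "norm (y n) \<le> sup_norm y"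
proof -
  obtain B where "norm (y n) \<le> B" for n
    using assms by (auto simp: l_infty_def bounded_iff)
  then have "bdd_above (range (\<lambda>n. norm (y n)))"
    by (intro bdd_aboveI2)
  then show ?thesis
    unfolding sup_norm_def by (intro cSUP_upper) auto
qed

lemma sup_norm_le:
  assumes "\<And>n. norm (y n) \<le> B"
  shows "sup_norm y \<le> B"
  using assms unfolding sup_norm_def by (intro cSUP_least) auto

lemma vector_space_seq_scale: "vector_space (seq_scale :: 'a::field \<Rightarrow> _)"
  by unfold_locales (auto simp: seq_scale_def algebra_simps)

lemma normed_space_on_sup_norm:
  fixes X :: "(nat \<Rightarrow> 'a::real_normed_field) set"
  assumes sub: "module.subspace seq_scale X" and bdd: "X \<subseteq> l_infty"
  shows "normed_space_on seq_scale X sup_norm"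
proof -
  interpret vector_space "seq_scale :: 'a \<Rightarrow> _"
    by (rule vector_space_seq_scale)
  have le: "norm (x n) \<le> sup_norm x" if "x \<in> X" for x n
    using that bdd by (intro norm_le_sup_norm) auto
  have nonneg: "0 \<le> sup_norm x" if "x \<in> X" for x
    using norm_ge_zero le[OF that] by (rule order_trans)
  have zero_iff: "sup_norm x = 0 \<longleftrightarrow> x = 0" if "x \<in> X" for x
  proof
    assume "sup_norm x = 0"
    then have "x n = 0" for n
      using le[OF that, of n] by simp
    then show "x = 0"
      by auto
  qed (simp add: sup_norm_def)
  have scale_le: "sup_norm (seq_scale a x) \<le> norm a * sup_norm x" if "x \<in> X" for a x
    by (rule sup_norm_le) (simp add: seq_scale_def norm_mult mult_left_mono le[OF that])
  have scale: "sup_norm (seq_scale a x) = norm a * sup_norm x" if "x \<in> X" for a x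
  proof (cases "a = 0")
    case True
    then show ?thesis
      by (simp add: seq_scale_def sup_norm_def)
  next
    case False
    \<comment> \<open>The reverse inequality is the inequality for the inverse scalar, applied to \<open>a x\<close>.\<close>
    have "sup_norm x \<le> norm (inverse a) * sup_norm (seq_scale a x)"
      using scale_le[OF subspace_scale[OF sub that], of "inverse a" a] False
      by simp
    then have "norm a * sup_norm x \<le> sup_norm (seq_scale a x)"
      using False by (simp add: norm_divide field_simps)
    with scale_le[OF that] show ?thesis
      by (rule antisym)
  qed
  have tri: "sup_norm (x + y) \<le> sup_norm x + sup_norm y" if "x \<in> X" "y \<in> X" for x y
    using le[OF that(1)] le[OF that(2)]
    by (intro sup_norm_le) (auto intro: norm_triangle_mono)
  show ?thesis
    unfolding normed_space_on_def
    using vector_space_axioms sub nonneg zero_iff scale tri by blast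
qed

text \<open>
  Cauchy in the supremum norm is uniformly Cauchy, so completeness of the scalars gives a uniform
  limit; the closure hypothesis is exactly what keeps this limit in \<open>X\<close>.
\<close>

lemma complete_sup_normed:
  fixes X :: "(nat \<Rightarrow> 'a::{real_normed_field, banach}) set"
  assumes sub: "module.subspace seq_scale X" and bdd: "X \<subseteq> l_infty"
    and closed: "\<And>\<sigma> y. range \<sigma> \<subseteq> X \<Longrightarrow> uniform_limit UNIV \<sigma> y sequentially \<Longrightarrow> y \<in> X"
  shows "complete_normed_space_on seq_scale X sup_norm"
proof -
  interpret vector_space "seq_scale :: 'a \<Rightarrow> _"
    by (rule vector_space_seq_scale)
  have norm: "normed_space_on seq_scale X sup_norm"
    using sub bdd by (rule normed_space_on_sup_norm)
  have le: "norm (x n - y n) \<le> sup_norm (x - y)" if "x \<in> X" "y \<in> X" for x y n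
    using norm_le_sup_norm[of "x - y" n] subspace_diff[OF sub that] bdd by auto
  have "\<exists>y\<in>X. (\<lambda>i. sup_norm (\<sigma> i - y)) \<longlonglongrightarrow> 0"
    if \<sigma>: "range \<sigma> \<subseteq> X"
      and Cauchy: "\<forall>\<epsilon>>0. \<exists>K. \<forall>i\<ge>K. \<forall>j\<ge>K. sup_norm (\<sigma> i - \<sigma> j) < \<epsilon>" for \<sigma>
  proof -
    have mem: "\<sigma> i \<in> X" for i
      using \<sigma> by auto
    have "uniformly_Cauchy_on UNIV \<sigma>"
      unfolding uniformly_Cauchy_on_def dist_norm
      using Cauchy le[OF mem mem] by (meson order_le_less_trans)
    then obtain y where y: "uniform_limit UNIV \<sigma> y sequentially"
      using Cauchy_uniformly_convergent uniformly_convergent_on_def by blast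
    have "y \<in> X"
      using \<sigma> y by (rule closed)
    moreover have "(\<lambda>i. sup_norm (\<sigma> i - y)) \<longlonglongrightarrow> 0"
    proof (rule tendstoI)
      fix \<epsilon> :: real
      assume "\<epsilon> > 0"
      then have "\<forall>\<^sub>F i in sequentially. \<forall>n\<in>UNIV. dist (\<sigma> i n) (y n) < \<epsilon> / 2"
        using y by (intro uniform_limitD) auto
      then show "\<forall>\<^sub>F i in sequentially. dist (sup_norm (\<sigma> i - y)) 0 < \<epsilon>"
      proof eventually_elim
        case (elim i)
        have "sup_norm (\<sigma> i - y) \<le> \<epsilon> / 2"
          using elim by (intro sup_norm_le) (auto simp: dist_norm intro: less_imp_le)
        moreover have "0 \<le> sup_norm (\<sigma> i - y)"
          using norm_ge_zero le[OF mem \<open>y \<in> X\<close>] by (rule order_trans)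
        ultimately show ?case
          using \<open>\<epsilon> > 0\<close> by (simp add: dist_norm)
      qed
    qed
    ultimately show ?thesis
      by blast
  qed
  with norm show ?thesis
    by (simp add: complete_normed_space_on_def mcomplete_norm_dist_iff[OF norm])
qed

section \<open>Bounded, convergent and null sequences\<close>

lemma c_null_subset_c_conv: "c_null \<subseteq> c_conv"
  by (auto simp: c_null_def c_conv_def convergent_def)

lemma c_conv_subset_l_infty: "c_conv \<subseteq> l_infty"
  by (auto simp: c_conv_def l_infty_def convergent_def intro: convergent_imp_bounded)

lemma subspace_l_infty: "module.subspace seq_scale (l_infty :: (nat \<Rightarrow> 'a::real_normed_field) set)"
proof -
  interpret vector_space "seq_scale :: 'a \<Rightarrow> _"
    by (rule vector_space_seq_scale)
  have "bounded (range (\<lambda>n. a * x n))" if "bounded (range x)" for a :: 'a and x :: "nat \<Rightarrow> 'a"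
    using bounded_linear_image[OF that bounded_linear_mult_right, of a] by (simp add: image_comp o_def)
  then show ?thesis
    unfolding l_infty_def
    by (intro subspaceI) (auto simp: seq_scale_def plus_fun_def intro!: bounded_plus_comp)
qed

lemma subspace_c_conv: "module.subspace seq_scale (c_conv :: (nat \<Rightarrow> 'a::real_normed_field) set)"
proof -
  interpret vector_space "seq_scale :: 'a \<Rightarrow> _"
    by (rule vector_space_seq_scale)
  show ?thesis
    unfolding c_conv_def
    by (intro subspaceI)
      (auto simp: seq_scale_def plus_fun_def zero_fun_def convergent_const
        intro: convergent_add convergent_mult)
qed

lemma subspace_c_null: "module.subspace seq_scale (c_null :: (nat \<Rightarrow> 'a::real_normed_field) set)"
proof -
  interpret vector_space "seq_scale :: 'a \<Rightarrow> _"
    by (rule vector_space_seq_scale)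
  show ?thesis
    unfolding c_null_def
    by (intro subspaceI)
      (auto simp: seq_scale_def plus_fun_def zero_fun_def
        intro: tendsto_add_zero tendsto_mult_right_zero)
qed

lemma uniform_limit_close:
  assumes "uniform_limit UNIV \<sigma> y sequentially" and "range \<sigma> \<subseteq> X" and "\<epsilon> > 0"
  obtains x where "x \<in> X" and "\<And>n. dist (x n) (y n) < \<epsilon>"
proof -
  have "\<forall>\<^sub>F i in sequentially. \<forall>n\<in>UNIV. dist (\<sigma> i n) (y n) < \<epsilon>"
    using assms(1,3) by (rule uniform_limitD)
  then obtain i where "\<forall>n. dist (\<sigma> i n) (y n) < \<epsilon>"
    using eventually_happens[of _ sequentially] by auto
  with assms(2) show thesis
    by (intro that[of "\<sigma> i"]) auto
qed

lemma l_infty_uniform_limit: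
  assumes "range \<sigma> \<subseteq> l_infty" and "uniform_limit UNIV \<sigma> y sequentially"
  shows "y \<in> l_infty"
proof -
  obtain x where x: "x \<in> l_infty" "\<And>n. dist (x n) (y n) < 1"
    using uniform_limit_close[OF assms(2,1), of 1] by auto
  have "norm (y n) \<le> sup_norm x + 1" for n
    using norm_le_sup_norm[OF x(1), of n] x(2)[of n] norm_triangle_sub[of "y n" "x n"]
    by (simp add: dist_norm norm_minus_commute)
  then show ?thesis
    by (auto simp: l_infty_def bounded_iff)
qed

text \<open>
  Comparing with a convergent sequence at distance less than \<open>\<epsilon> / 3\<close> shows that the limit is
  Cauchy. This avoids having to identify its limit.
\<close>

lemma c_conv_uniform_limit:
  fixes y :: "nat \<Rightarrow> 'a::banach"
  assumes "range \<sigma> \<subseteq> c_conv" and "uniform_limit UNIV \<sigma> y sequentially"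
  shows "y \<in> c_conv"
proof -
  have "Cauchy y"
  proof (rule metric_CauchyI)
    fix \<epsilon> :: real
    assume "\<epsilon> > 0"
    then obtain x where x: "x \<in> c_conv" "\<And>n. dist (x n) (y n) < \<epsilon> / 3"
      using uniform_limit_close[OF assms(2,1), of "\<epsilon> / 3"] by auto
    then have "Cauchy x"
      by (simp add: c_conv_def convergent_Cauchy)
    then obtain K where K: "\<And>m n. m \<ge> K \<Longrightarrow> n \<ge> K \<Longrightarrow> dist (x m) (x n) < \<epsilon> / 3"
      using \<open>\<epsilon> > 0\<close> metric_CauchyD[of x "\<epsilon> / 3"] by auto
    have "dist (y m) (y n) < \<epsilon>" if "m \<ge> K" "n \<ge> K" for m n
    proof -
      have "dist (y m) (y n) \<le> dist (x m) (y m) + dist (x m) (x n) + dist (x n) (y n)"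
        by metric
      then show ?thesis
        using K[OF that] x(2)[of m] x(2)[of n] by simp
    qed
    then show "\<exists>K. \<forall>m\<ge>K. \<forall>n\<ge>K. dist (y m) (y n) < \<epsilon>"
      by blast
  qed
  then show ?thesis
    by (simp add: c_conv_def Cauchy_convergent)
qed

lemma c_null_uniform_limit:
  assumes "range \<sigma> \<subseteq> c_null" and "uniform_limit UNIV \<sigma> y sequentially"
  shows "y \<in> c_null"
proof -
  have "y \<longlonglongrightarrow> 0"
  proof (rule tendstoI)
    fix \<epsilon> :: real
    assume "\<epsilon> > 0"
    then obtain x where x: "x \<in> c_null" "\<And>n. dist (x n) (y n) < \<epsilon> / 2"
      using uniform_limit_close[OF assms(2,1), of "\<epsilon> / 2"] by auto
    then have "\<forall>\<^sub>F n in sequentially. dist (x n) 0 < \<epsilon> / 2"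
      using \<open>\<epsilon> > 0\<close> by (intro tendstoD) (simp_all add: c_null_def)
    then show "\<forall>\<^sub>F n in sequentially. dist (y n) 0 < \<epsilon>"
    proof eventually_elim
      case (elim n)
      have "dist (y n) 0 \<le> dist (x n) (y n) + dist (x n) 0"
        by metric
      with elim x(2)[of n] show ?case
        by simp
    qed
  qed
  then show ?thesis
    by (simp add: c_null_def)
qed

lemma complete_classical_sequence_space:
  fixes X :: "(nat \<Rightarrow> 'a::{real_normed_field, banach}) set"
  assumes "X \<in> {l_infty, c_conv, c_null}"
  shows "complete_normed_space_on seq_scale X sup_norm"
proof -
  from assms consider "X = l_infty" | "X = c_conv" | "X = c_null"
    by auto
  then show ?thesis
  proof cases
    case 1
    show ?thesis
      unfolding 1 by (rule complete_sup_normed[OF subspace_l_infty order_refl l_infty_uniform_limit])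
  next
    case 2
    show ?thesis
      unfolding 2 by (rule complete_sup_normed[OF subspace_c_conv c_conv_subset_l_infty c_conv_uniform_limit])
  next
    case 3
    show ?thesis
      unfolding 3
      by (rule complete_sup_normed[OF subspace_c_null
            subset_trans[OF c_null_subset_c_conv c_conv_subset_l_infty] c_null_uniform_limit])
  qed
qed

section \<open>The generalized mean as a linear bijection\<close>

lemma linear_gen_mean: "Vector_Spaces.linear seq_scale seq_scale (gen_mean r s t)"
proof -
  interpret vector_space seq_scale
    by (rule vector_space_seq_scale)
  show ?thesis
  proof unfold_locales
    show "gen_mean r s t (x + y) = gen_mean r s t x + gen_mean r s t y" for x y
    proof
      fix n
      have "bdiff (x + y) k = bdiff x k + bdiff y k" for k
        by (simp add: bdiff_def)
      then show "gen_mean r s t (x + y) n = (gen_mean r s t x + gen_mean r s t y) n"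
        by (simp add: gen_mean_def distrib_left sum.distrib add_divide_distrib)
    qed
    show "gen_mean r s t (seq_scale a x) = seq_scale a (gen_mean r s t x)" for a x
    proof
      fix n
      have "bdiff (seq_scale a x) k = a * bdiff x k" for k
        by (simp add: bdiff_def seq_scale_def algebra_simps)
      then show "gen_mean r s t (seq_scale a x) n = seq_scale a (gen_mean r s t x) n"
        by (simp add: gen_mean_def seq_scale_def sum_distrib_left mult_ac)
    qed
  qed
qed

lemma bdiff_partial_sum: "bdiff (\<lambda>n. \<Sum>k\<le>n. u k) = u"
proof
  fix k
  show "bdiff (\<lambda>n. \<Sum>k\<le>n. u k) k = u k"
    by (cases k) (simp_all add: bdiff_def)
qed

lemma sum_bdiff: "(\<Sum>k\<le>n. bdiff x k) = x n"
  by (induction n) (simp_all add: bdiff_def)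

lemma gen_mean_eq_fps_nth:
  "gen_mean r s t x n = fps_nth (Abs_fps (\<lambda>k. t k * bdiff x k) * Abs_fps s) n / r n"
  unfolding gen_mean_def fps_mult_nth by (simp add: ac_simps)

text \<open>
  The power series \<open>S\<close> with coefficients \<open>s\<close> is invertible. Cancelling it recovers the
  differences of \<open>x\<close>, and hence \<open>x\<close>, from the mean; multiplying by its inverse supplies the
  preimage of an arbitrary sequence.
\<close>

lemma bij_gen_mean:
  fixes r s t :: "nat \<Rightarrow> 'a::field"
  assumes r: "\<And>n. r n \<noteq> 0" and t: "\<And>n. t n \<noteq> 0" and s: "s 0 \<noteq> 0"
  shows "bij (gen_mean r s t)"
proof (rule bijI)
  define S where "S = Abs_fps s"
  have inv: "S * inverse S = 1"
    using s by (simp add: S_def inverse_mult_eq_1')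
  show "inj (gen_mean r s t)"
  proof (rule injI)
    fix x y
    assume eq: "gen_mean r s t x = gen_mean r s t y"
    have "Abs_fps (\<lambda>k. t k * bdiff x k) * S = Abs_fps (\<lambda>k. t k * bdiff y k) * S"
    proof (rule fps_ext)
      fix n
      show "fps_nth (Abs_fps (\<lambda>k. t k * bdiff x k) * S) n =
          fps_nth (Abs_fps (\<lambda>k. t k * bdiff y k) * S) n"
        using fun_cong[OF eq, of n] r[of n] by (simp add: gen_mean_eq_fps_nth S_def)
    qed
    moreover have "S \<noteq> 0"
      using inv by auto
    ultimately have "Abs_fps (\<lambda>k. t k * bdiff x k) = Abs_fps (\<lambda>k. t k * bdiff y k)"
      by simp
    then have "bdiff x k = bdiff y k" for k
      using t[of k] by (auto simp: fps_eq_iff)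
    then show "x = y"
      using sum_bdiff[of x] sum_bdiff[of y] by (simp add: fun_eq_iff)
  qed
  show "surj (gen_mean r s t)"
    unfolding surj_def
  proof
    fix y
    define U where "U = Abs_fps (\<lambda>n. r n * y n) * inverse S"
    define x where "x = (\<lambda>n. \<Sum>k\<le>n. fps_nth U k / t k)"
    have "Abs_fps (\<lambda>k. t k * bdiff x k) = U"
      using t by (simp add: x_def bdiff_partial_sum fps_eq_iff)
    moreover have "U * S = Abs_fps (\<lambda>n. r n * y n)"
      using inv by (simp add: U_def mult_ac)
    ultimately have "y = gen_mean r s t x"
      using r by (simp add: fun_eq_iff gen_mean_eq_fps_nth S_def)
    then show "\<exists>x. y = gen_mean r s t x"
      by blast
  qed
qed

theorem theorem4p1:
  fixes r s t :: "nat \<Rightarrow> 'a::{real_normed_field, banach}"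
    and X :: "(nat \<Rightarrow> 'a) set"
  assumes "\<And>n. r n \<noteq> 0"
    and "\<And>n. t n \<noteq> 0"
    and "s 0 \<noteq> 0"
    and "X \<in> {l_infty, c_conv, c_null}"
  shows "complete_normed_space_on seq_scale (mean_space X r s t) (mean_norm r s t)"
proof -
  have "mean_space X r s t = gen_mean r s t -` X"
    by (auto simp: mean_space_def)
  moreover have "mean_norm r s t = (\<lambda>x. sup_norm (gen_mean r s t x))"
    by (simp add: fun_eq_iff mean_norm_def sup_norm_def)
  moreover have "bij (gen_mean r s t)"
    using assms(1-3) by (rule bij_gen_mean)
  ultimately show ?thesis
    using complete_normed_space_on_pullback[OF linear_gen_mean _
        complete_classical_sequence_space[OF assms(4)]]
    by simp
qed

end
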